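(* Let $(A,\alpha,\mu)$ be a Hom-associative algebra and let $r,s\in A^{\otimes 2}$ be two $\alpha$-invariant elements. Define maps $\triangle',\delta_r,\delta_s:A\to A\otimes A$ by $$\triangle'(a)=ar-sa,\qquad\delta_r(a)=ar-ra,\qquad\delta_s(a)=as-sa.$$ Then $(A,\alpha,\mu,\triangle',\delta_r,\delta_s)$ is a covariant Hom-bialgebra if and only if for all $a\in A$ $$a\bullet(r_{13}r_{12}-r_{12}r_{23}+s_{23}r_{13})=(s_{13}r_{12}-s_{12}s_{23}+s_{23}s_{13})\bullet a.$$
   Context: All vector spaces, linear maps and tensor products are over a field $\mathbb{K}$. A (multiplicative) Hom-associative algebra $(A,\alpha,\mu)$ is a vector space $A$ with a linear map $\alpha:A\to A$ and a bilinear map $\mu:A\otimes A\to A$, $a\otimes b\mapsto a\cdot b$, such that $(a\cdot b)\cdot\alpha(c)=\alpha(a)\cdot(b\cdot c)$ and $\alpha(a\cdot b)=\alpha(a)\cdot\alpha(b)$ for all $a,b,c\in A$. A (multiplicative) Hom-coassociative coalgebra $(A,\alpha,\triangle)$ is a vector space $A$ with linear maps $\alpha:A\to A$ and $\triangle:A\to A\otimes A$ such that $(\triangle\otimes\alpha)\circ\triangle=(\alpha\otimes\triangle)\circ\triangle$ and $(\alpha\otimes\alpha)\circ\triangle=\triangle\circ\alpha$. Multiplicativity is always assumed. Given a Hom-associative algebra $(A,\alpha,\mu)$, a linear map $d:A\to A\otimes A$ is a derivation on $A$ with values in the $A$-bimodule $A\otimes A$ if $\alpha^{\otimes 2}\circ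 d=d\circ\alpha$ and $$d\circ\mu=(\mu\otimes\alpha)\circ(\alpha\otimes d)+(\alpha\otimes\mu)\circ(d\otimes\alpha).$$ Given two such derivations $\delta_1,\delta_2$, a linear map $D:A\to A\otimes A$ is a covariant derivation with respect to $(\delta_1,\delta_2)$ if $\alpha^{\otimes 2}\circ D=D\circ\alpha$ and $$D\circ\mu=(\mu\otimes\alpha)\circ(\alpha\otimes\delta_1)+(\alpha\otimes\mu)\circ(D\otimes\alpha),$$ $$D\circ\mu=(\mu\otimes\alpha)\circ(\alpha\otimes D)+(\alpha\otimes\mu)\circ(\delta_2\otimes\alpha).$$ A covariant Hom-bialgebra is a tuple $(A,\alpha,\mu,\triangle,\delta_1,\delta_2)$ such that $(A,\alpha,\mu)$ is a Hom-associative algebra, $(A,\alpha,\triangle)$ is a Hom-coassociative coalgebra, $\delta_1,\delta_2:A\to A\otimes A$ are derivations on $A$ with values in $A\otimes A$, and $\triangle$ is a covariant derivation with respect to $(\delta_1,\delta_2)$. Elements of $A^{\otimes 2}$ are written $r=r_{(1)}\otimes r_{(2)}$ with the (finite) summation sign suppressed; $r$ is $\alpha$-invariant if $(\alpha\otimes\alpha)(r)=r$. For $a\in A$ and $r\in A^{\otimes 2}$, $$ar=a\cdot r_{(1)}\otimes\alpha(r_{(2)}),\qquad ra=\alpha(r_{(1)})\otimes r_{(2)}\cdot a.$$ For $\alpha$-invariant $r,s\in A^{\otimes 2}$ define elements of $A^{\otimes 3}$ by $$r_{13}s_{12}=r_{(1)}\cdot s_{(1)}\otimes\alpha(s_{(2)})\otimes\alpha(r_{(2)}),$$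 $$r_{12}s_{23}=\alpha(r_{(1)})\otimes r_{(2)}\cdot s_{(1)}\otimes\alpha(s_{(2)}),$$ $$r_{23}s_{13}=\alpha(s_{(1)})\otimes\alpha(r_{(1)})\otimes r_{(2)}\cdot s_{(2)}$$ (the same formulas are used when both elements coincide, with two independent copies). The actions of $A$ on $A^{\otimes n}$ are $$a\bullet(b_1\otimes\cdots\otimes b_n)=\alpha(a)\cdot b_1\otimes\alpha(b_2)\otimes\cdots\otimes\alpha(b_n),\qquad(b_1\otimes\cdots\otimes b_n)\bullet a=\alpha(b_1)\otimes\cdots\otimes\alpha(b_{n-1})\otimes b_n\cdot\alpha(a).$$ *)

theory Defs
  imports Complex_Main "HOL-Library.Poly_Mapping"
begin

section \<open>Tensor powers of a vector space\<close>

text \<open>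
  Let \<open>sc\<close> be the scalar multiplication of a \<open>'k\<close>-vector space \<open>A\<close> on the type \<open>'a\<close>. All tensor
  powers of \<open>A\<close> are graded pieces of one space: the free vector space on words over \<open>A\<close>, modulo
  the subspace generated by the multilinearity relations. Elements of the quotient are cosets. The
  relations are homogeneous in the word length, so the classes of combinations of words of length
  \<open>n\<close> form the \<open>n\<close>-th tensor power. Concatenation of words gives the product of a
  tensor of degree \<open>m\<close> with one of degree \<open>n\<close>, so that the bracketings of
  \<open>A \<otimes> A \<otimes> A\<close> are identified in the usual way.
\<close>

type_synonym ('k, 'a) free = "'a list \<Rightarrow>\<^sub>0 'k"
type_synonym ('k, 'a) tensor = "('k, 'a) free set"

definition fscale :: "'k::field \<Rightarrow> ('k, 'a) free \<Rightarrow> ('k, 'a) free" where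
  "fscale c p = Poly_Mapping.map ((*) c) p"

definition word :: "'a list \<Rightarrow> ('k::field, 'a) free" where
  "word xs = Poly_Mapping.single xs 1"

definition multilinear_relations ::
    "('k::field \<Rightarrow> 'a::ab_group_add \<Rightarrow> 'a) \<Rightarrow> ('k, 'a) free set" where
  "multilinear_relations sc =
     {word (us @ (x + y) # vs) - word (us @ x # vs) - word (us @ y # vs) | us vs x y. True} \<union>
     {word (us @ sc c x # vs) - fscale c (word (us @ x # vs)) | us vs c x. True}"

definition null_space :: "('k::field \<Rightarrow> 'a::ab_group_add \<Rightarrow> 'a) \<Rightarrow> ('k, 'a) free set" where
  "null_space sc = module.span fscale (multilinear_relations sc)"

definition cls :: "('k::field \<Rightarrow> 'a::ab_group_add \<Rightarrow> 'a) \<Rightarrow> ('k, 'a) free \<Rightarrow> ('k, 'a) tensor" where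
  "cls sc p = {q. q - p \<in> null_space sc}"

definition rep :: "('k::field, 'a) tensor \<Rightarrow> ('k, 'a) free" where
  "rep t = (SOME p. p \<in> t)"

definition tensor_power ::
    "('k::field \<Rightarrow> 'a::ab_group_add \<Rightarrow> 'a) \<Rightarrow> nat \<Rightarrow> ('k, 'a) tensor set" where
  "tensor_power sc n = cls sc ` {p. \<forall>xs \<in> Poly_Mapping.keys p. length xs = n}"

text \<open>
  The operations below are given on representatives; independence of the choice is shown at the
  end of this section.
\<close>

definition pure :: "('k::field \<Rightarrow> 'a::ab_group_add \<Rightarrow> 'a) \<Rightarrow> 'a list \<Rightarrow> ('k, 'a) tensor" where
  "pure sc xs = cls sc (word xs)"

definition tzero :: "('k::field \<Rightarrow> 'a::ab_group_add \<Rightarrow> 'a) \<Rightarrow> ('k, 'a) tensor" where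
  "tzero sc = cls sc 0"

definition tplus :: "('k::field \<Rightarrow> 'a::ab_group_add \<Rightarrow> 'a) \<Rightarrow>
    ('k, 'a) tensor \<Rightarrow> ('k, 'a) tensor \<Rightarrow> ('k, 'a) tensor" where
  "tplus sc s t = cls sc (rep s + rep t)"

definition tminus :: "('k::field \<Rightarrow> 'a::ab_group_add \<Rightarrow> 'a) \<Rightarrow>
    ('k, 'a) tensor \<Rightarrow> ('k, 'a) tensor \<Rightarrow> ('k, 'a) tensor" where
  "tminus sc s t = cls sc (rep s - rep t)"

definition tscale :: "('k::field \<Rightarrow> 'a::ab_group_add \<Rightarrow> 'a) \<Rightarrow>
    'k \<Rightarrow> ('k, 'a) tensor \<Rightarrow> ('k, 'a) tensor" where
  "tscale sc c t = cls sc (fscale c (rep t))"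

text \<open>The linear map on tensors that a multilinear map \<open>F\<close> on words induces:\<close>

definition lift :: "('k::field \<Rightarrow> 'a::ab_group_add \<Rightarrow> 'a) \<Rightarrow>
    ('a list \<Rightarrow> ('k, 'a) tensor) \<Rightarrow> ('k, 'a) tensor \<Rightarrow> ('k, 'a) tensor" where
  "lift sc F t = cls sc
     (\<Sum>xs \<in> Poly_Mapping.keys (rep t). fscale (Poly_Mapping.lookup (rep t) xs) (rep (F xs)))"

text \<open>
  \<open>lift2 sc F\<close> is the linear map with \<open>x \<otimes> y \<mapsto> F x y\<close>, for bilinear \<open>F\<close>; on the pieces of degree
  other than 2 it vanishes. Likewise \<open>lift3\<close> and \<open>lift4\<close>.
\<close>

definition lift2 :: "('k::field \<Rightarrow> 'a::ab_group_add \<Rightarrow> 'a) \<Rightarrow>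
    ('a \<Rightarrow> 'a \<Rightarrow> ('k, 'a) tensor) \<Rightarrow> ('k, 'a) tensor \<Rightarrow> ('k, 'a) tensor" where
  "lift2 sc F = lift sc (\<lambda>xs. case xs of [x, y] \<Rightarrow> F x y | _ \<Rightarrow> tzero sc)"

definition lift3 :: "('k::field \<Rightarrow> 'a::ab_group_add \<Rightarrow> 'a) \<Rightarrow>
    ('a \<Rightarrow> 'a \<Rightarrow> 'a \<Rightarrow> ('k, 'a) tensor) \<Rightarrow> ('k, 'a) tensor \<Rightarrow> ('k, 'a) tensor" where
  "lift3 sc F = lift sc (\<lambda>xs. case xs of [x, y, z] \<Rightarrow> F x y z | _ \<Rightarrow> tzero sc)"

definition lift4 :: "('k::field \<Rightarrow> 'a::ab_group_add \<Rightarrow> 'a) \<Rightarrow>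
    ('a \<Rightarrow> 'a \<Rightarrow> 'a \<Rightarrow> 'a \<Rightarrow> ('k, 'a) tensor) \<Rightarrow> ('k, 'a) tensor \<Rightarrow> ('k, 'a) tensor" where
  "lift4 sc F = lift sc (\<lambda>xs. case xs of [x, y, z, w] \<Rightarrow> F x y z w | _ \<Rightarrow> tzero sc)"

definition tprod :: "('k::field \<Rightarrow> 'a::ab_group_add \<Rightarrow> 'a) \<Rightarrow>
    ('k, 'a) tensor \<Rightarrow> ('k, 'a) tensor \<Rightarrow> ('k, 'a) tensor" where
  "tprod sc s t = lift sc (\<lambda>xs. lift sc (\<lambda>ys. pure sc (xs @ ys)) t) s"

definition multilinear :: "('k::field \<Rightarrow> 'a::ab_group_add \<Rightarrow> 'a) \<Rightarrow>
    ('a list \<Rightarrow> ('k, 'a) tensor) \<Rightarrow> bool" where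
  "multilinear sc F \<longleftrightarrow> (\<forall>xs. F xs \<in> range (cls sc)) \<and>
     (\<forall>us vs x y. F (us @ (x + y) # vs) = tplus sc (F (us @ x # vs)) (F (us @ y # vs))) \<and>
     (\<forall>us vs c x. F (us @ sc c x # vs) = tscale sc c (F (us @ x # vs)))"

lemma lookup_fscale [simp]: "Poly_Mapping.lookup (fscale c p) k = c * Poly_Mapping.lookup p k"
  unfolding fscale_def by transfer (simp add: when_def)

lemma vector_space_fscale: "vector_space fscale"
  by unfold_locales (auto intro!: poly_mapping_eqI simp: lookup_add algebra_simps)

interpretation free: vector_space "fscale :: 'k::field \<Rightarrow> ('k, 'a) free \<Rightarrow> ('k, 'a) free"
  by (rule vector_space_fscale)

lemma subspace_null_space: "free.subspace (null_space sc)"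
  unfolding null_space_def by (rule free.subspace_span)

lemma cls_eq_iff: "cls sc p = cls sc q \<longleftrightarrow> p - q \<in> null_space sc"
proof
  have "p \<in> cls sc p"
    using free.subspace_0[OF subspace_null_space] by (simp add: cls_def)
  then show "p - q \<in> null_space sc" if "cls sc p = cls sc q"
    using that by (auto simp: cls_def)
  show "cls sc p = cls sc q" if pq: "p - q \<in> null_space sc"
  proof -
    have "u - p \<in> null_space sc \<longleftrightarrow> u - q \<in> null_space sc" for u
      using free.subspace_add[OF subspace_null_space _ pq, of "u - p"]
        free.subspace_diff[OF subspace_null_space _ pq, of "u - q"] by auto
    then show ?thesis by (simp add: cls_def)
  qed
qed

lemma cls_rep: "t \<in> range (cls sc) \<Longrightarrow> cls sc (rep t) = t"
proof -
  assume "t \<in> range (cls sc)"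
  then obtain p where p: "t = cls sc p" by blast
  then have "p \<in> t"
    using free.subspace_0[OF subspace_null_space] by (simp add: cls_def)
  then have "rep t \<in> t" unfolding rep_def by (rule someI)
  with p show ?thesis by (simp add: cls_eq_iff) (simp add: cls_def)
qed

lemma rep_cls: "rep (cls sc p) - p \<in> null_space sc"
  using cls_rep[OF rangeI, of sc p] by (simp only: cls_eq_iff)

lemma tplus_cls: "tplus sc (cls sc p) (cls sc q) = cls sc (p + q)"
  using free.subspace_add[OF subspace_null_space rep_cls[of sc p] rep_cls[of sc q]]
  by (simp add: tplus_def cls_eq_iff algebra_simps)

lemma tminus_cls: "tminus sc (cls sc p) (cls sc q) = cls sc (p - q)"
  using free.subspace_diff[OF subspace_null_space rep_cls[of sc p] rep_cls[of sc q]]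
  by (simp add: tminus_def cls_eq_iff algebra_simps)

lemma tscale_cls: "tscale sc c (cls sc p) = cls sc (fscale c p)"
  using free.subspace_scale[OF subspace_null_space rep_cls[of sc p], of c]
  by (simp add: tscale_def cls_eq_iff free.scale_right_diff_distrib)

definition free_ext :: "('a list \<Rightarrow> ('k::field, 'a) tensor) \<Rightarrow> ('k, 'a) free \<Rightarrow> ('k, 'a) free" where
  "free_ext F p = (\<Sum>xs \<in> Poly_Mapping.keys p. fscale (Poly_Mapping.lookup p xs) (rep (F xs)))"

lemma lift_eq_cls_free_ext: "lift sc F t = cls sc (free_ext F (rep t))"
  by (simp add: lift_def free_ext_def)

lemma free_ext_superset:
  assumes "finite K" "Poly_Mapping.keys p \<subseteq> K"
  shows "free_ext F p = (\<Sum>xs \<in> K. fscale (Poly_Mapping.lookup p xs) (rep (F xs)))"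
  unfolding free_ext_def
  by (rule sum.mono_neutral_left) (use assms in \<open>auto simp: in_keys_iff\<close>)

lemma free_ext_linear: "Vector_Spaces.linear fscale fscale (free_ext F)"
  unfolding Vector_Spaces.linear_iff
proof (intro conjI allI vector_space_fscale)
  fix p q :: "('a, 'b) free" and c :: 'a
  let ?K = "Poly_Mapping.keys p \<union> Poly_Mapping.keys q"
  have "Poly_Mapping.keys (p + q) \<subseteq> ?K"
    by (rule keys_add)
  then show "free_ext F (p + q) = free_ext F p + free_ext F q"
    by (simp add: free_ext_superset[of ?K] lookup_add free.scale_left_distrib sum.distrib)
  have "Poly_Mapping.keys (fscale c p) \<subseteq> Poly_Mapping.keys p"
    by (auto simp: in_keys_iff)
  then show "free_ext F (fscale c p) = fscale c (free_ext F p)"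
    by (simp add: free_ext_superset[of "Poly_Mapping.keys p"] free.scale_sum_right)
qed

lemma free_ext_word [simp]: "free_ext F (word xs) = rep (F xs)"
  by (simp add: free_ext_def word_def)

lemma free_ext_null_space:
  assumes F: "multilinear sc F" and p: "p \<in> null_space sc"
  shows "free_ext F p \<in> null_space sc"
proof -
  interpret L: Vector_Spaces.linear fscale fscale "free_ext F"
    by (rule free_ext_linear)
  have F_rep: "cls sc (rep (F xs)) = F xs" for xs
    using F by (intro cls_rep) (simp add: multilinear_def)
  have "free.subspace {p. free_ext F p \<in> null_space sc}"
    using L.subspace_vimage[OF subspace_null_space] by (simp add: vimage_def)
  moreover have "free_ext F p \<in> null_space sc" if "p \<in> multilinear_relations sc" for p
    using that unfolding multilinear_relations_def
  proof (elim UnE CollectE exE conjE)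
    fix us vs x y
    assume "p = word (us @ (x + y) # vs) - word (us @ x # vs) - word (us @ y # vs)"
    moreover have "cls sc (rep (F (us @ (x + y) # vs)))
        = cls sc (rep (F (us @ x # vs)) + rep (F (us @ y # vs)))"
      using F by (simp add: F_rep) (simp add: multilinear_def tplus_def)
    ultimately show ?thesis by (simp add: L.diff L.add cls_eq_iff diff_diff_add)
  next
    fix us vs c x
    assume "p = word (us @ sc c x # vs) - fscale c (word (us @ x # vs))"
    moreover have "cls sc (rep (F (us @ sc c x # vs))) = cls sc (fscale c (rep (F (us @ x # vs))))"
      using F by (simp add: F_rep) (simp add: multilinear_def tscale_def)
    ultimately show ?thesis by (simp add: L.diff L.scale cls_eq_iff)
  qed
  ultimately show ?thesis
    by (rule free.span_induct[OF p[unfolded null_space_def]])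
qed

lemma lift_cls:
  assumes "multilinear sc F"
  shows "lift sc F (cls sc p) = cls sc (free_ext F p)"
proof -
  interpret L: Vector_Spaces.linear fscale fscale "free_ext F"
    by (rule free_ext_linear)
  show ?thesis
    using free_ext_null_space[OF assms rep_cls[of sc p]]
    by (simp add: lift_eq_cls_free_ext cls_eq_iff L.diff)
qed

lemma lift_pure: "multilinear sc F \<Longrightarrow> lift sc F (pure sc xs) = F xs"
  by (simp add: pure_def lift_cls cls_rep multilinear_def)

lemma lift_tplus:
  assumes "multilinear sc F" "s \<in> range (cls sc)" "t \<in> range (cls sc)"
  shows "lift sc F (tplus sc s t) = tplus sc (lift sc F s) (lift sc F t)"
  using assms free_ext_linear[of F]
  by (auto simp: tplus_cls lift_cls linear_iff_module_hom module_hom.add)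

lemma lift_tscale:
  assumes "multilinear sc F" "t \<in> range (cls sc)"
  shows "lift sc F (tscale sc c t) = tscale sc c (lift sc F t)"
  using assms free_ext_linear[of F]
  by (auto simp: tscale_cls lift_cls linear_iff_module_hom module_hom.scale)

lemma pure_add: "pure sc (us @ (x + y) # vs) = tplus sc (pure sc (us @ x # vs)) (pure sc (us @ y # vs))"
proof -
  have "word (us @ (x + y) # vs) - word (us @ x # vs) - word (us @ y # vs) \<in> null_space sc"
    unfolding null_space_def
    by (rule free.span_base) (auto simp: multilinear_relations_def)
  then show ?thesis by (simp add: pure_def tplus_cls cls_eq_iff diff_diff_add)
qed

lemma pure_scale: "pure sc (us @ sc c x # vs) = tscale sc c (pure sc (us @ x # vs))"
proof -
  have "word (us @ sc c x # vs) - fscale c (word (us @ x # vs)) \<in> null_space sc"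
    unfolding null_space_def
    by (rule free.span_base) (unfold multilinear_relations_def, blast)
  then show ?thesis by (simp add: pure_def tscale_cls cls_eq_iff)
qed

lemma multilinear_append: "multilinear sc (\<lambda>ys. pure sc (xs @ ys))"
  unfolding multilinear_def
  using pure_add[of sc "xs @ _"] pure_scale[of sc "xs @ _"] by (auto simp: pure_def)

lemma free_ext_pointwise_add:
  assumes "\<And>xs. H xs = tplus sc (F xs) (G xs)"
  shows "cls sc (free_ext H p) = tplus sc (cls sc (free_ext F p)) (cls sc (free_ext G p))"
proof -
  have "fscale (Poly_Mapping.lookup p xs) (rep (H xs) - (rep (F xs) + rep (G xs))) \<in> null_space sc" for xs
    using rep_cls[of sc "rep (F xs) + rep (G xs)"]
    by (intro free.subspace_scale[OF subspace_null_space]) (simp add: assms tplus_def)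
  then have "(\<Sum>xs \<in> Poly_Mapping.keys p.
      fscale (Poly_Mapping.lookup p xs) (rep (H xs) - (rep (F xs) + rep (G xs)))) \<in> null_space sc"
    by (intro free.subspace_sum[OF subspace_null_space])
  then show ?thesis
    by (simp add: tplus_cls cls_eq_iff free_ext_def sum_subtractf sum.distrib
        free.scale_right_diff_distrib free.scale_right_distrib)
qed

lemma free_ext_pointwise_scale:
  assumes "\<And>xs. H xs = tscale sc c (F xs)"
  shows "cls sc (free_ext H p) = tscale sc c (cls sc (free_ext F p))"
proof -
  have "fscale (Poly_Mapping.lookup p xs) (rep (H xs) - fscale c (rep (F xs))) \<in> null_space sc" for xs
    using rep_cls[of sc "fscale c (rep (F xs))"]
    by (intro free.subspace_scale[OF subspace_null_space]) (simp add: assms tscale_def)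
  then have "(\<Sum>xs \<in> Poly_Mapping.keys p.
      fscale (Poly_Mapping.lookup p xs) (rep (H xs) - fscale c (rep (F xs)))) \<in> null_space sc"
    by (intro free.subspace_sum[OF subspace_null_space])
  then show ?thesis
    by (simp add: tscale_cls cls_eq_iff free_ext_def sum_subtractf
        free.scale_right_diff_distrib free.scale_sum_right mult.commute)
qed

lemma multilinear_tprod: "multilinear sc (\<lambda>xs. lift sc (\<lambda>ys. pure sc (xs @ ys)) t)"
  unfolding multilinear_def lift_eq_cls_free_ext
proof (intro conjI allI)
  show "cls sc (free_ext (\<lambda>ys. pure sc ((us @ (x + y) # vs) @ ys)) (rep t)) =
      tplus sc (cls sc (free_ext (\<lambda>ys. pure sc ((us @ x # vs) @ ys)) (rep t)))
               (cls sc (free_ext (\<lambda>ys. pure sc ((us @ y # vs) @ ys)) (rep t)))" for us vs x y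
    by (rule free_ext_pointwise_add) (simp add: pure_add)
  show "cls sc (free_ext (\<lambda>ys. pure sc ((us @ sc c x # vs) @ ys)) (rep t)) =
      tscale sc c (cls sc (free_ext (\<lambda>ys. pure sc ((us @ x # vs) @ ys)) (rep t)))" for us vs c x
    by (rule free_ext_pointwise_scale) (simp add: pure_scale)
qed auto

lemma tprod_pure: "tprod sc (pure sc xs) (pure sc ys) = pure sc (xs @ ys)"
  unfolding tprod_def
  by (rule trans[OF lift_pure[OF multilinear_tprod] lift_pure[OF multilinear_append]])

section \<open>Hom-associative algebras and Hom-coassociative coalgebras\<close>

definition tensor_linear :: "('k::field \<Rightarrow> 'a::ab_group_add \<Rightarrow> 'a) \<Rightarrow> nat \<Rightarrow>
    ('a \<Rightarrow> ('k, 'a) tensor) \<Rightarrow> bool" where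
  "tensor_linear sc n D \<longleftrightarrow> (\<forall>a. D a \<in> tensor_power sc n) \<and>
     (\<forall>a b. D (a + b) = tplus sc (D a) (D b)) \<and> (\<forall>c a. D (sc c a) = tscale sc c (D a))"

text \<open>The maps \<open>\<alpha> \<otimes> \<alpha>\<close>, \<open>\<alpha> \<otimes> D\<close>, \<open>D \<otimes> \<alpha>\<close>, \<open>\<mu> \<otimes> \<alpha>\<close> and \<open>\<alpha> \<otimes> \<mu>\<close>:\<close>

definition map_aa :: "('k::field \<Rightarrow> 'a::ab_group_add \<Rightarrow> 'a) \<Rightarrow> ('a \<Rightarrow> 'a) \<Rightarrow>
    ('k, 'a) tensor \<Rightarrow> ('k, 'a) tensor" where
  "map_aa sc \<alpha> = lift2 sc (\<lambda>x y. pure sc [\<alpha> x, \<alpha> y])"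

definition map_aD :: "('k::field \<Rightarrow> 'a::ab_group_add \<Rightarrow> 'a) \<Rightarrow> ('a \<Rightarrow> 'a) \<Rightarrow>
    ('a \<Rightarrow> ('k, 'a) tensor) \<Rightarrow> ('k, 'a) tensor \<Rightarrow> ('k, 'a) tensor" where
  "map_aD sc \<alpha> D = lift2 sc (\<lambda>x y. tprod sc (pure sc [\<alpha> x]) (D y))"

definition map_Da :: "('k::field \<Rightarrow> 'a::ab_group_add \<Rightarrow> 'a) \<Rightarrow> ('a \<Rightarrow> 'a) \<Rightarrow>
    ('a \<Rightarrow> ('k, 'a) tensor) \<Rightarrow> ('k, 'a) tensor \<Rightarrow> ('k, 'a) tensor" where
  "map_Da sc \<alpha> D = lift2 sc (\<lambda>x y. tprod sc (D x) (pure sc [\<alpha> y]))"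

definition map_ma :: "('k::field \<Rightarrow> 'a::ab_group_add \<Rightarrow> 'a) \<Rightarrow> ('a \<Rightarrow> 'a) \<Rightarrow>
    ('a \<Rightarrow> 'a \<Rightarrow> 'a) \<Rightarrow> ('k, 'a) tensor \<Rightarrow> ('k, 'a) tensor" where
  "map_ma sc \<alpha> \<mu> = lift3 sc (\<lambda>x y z. pure sc [\<mu> x y, \<alpha> z])"

definition map_am :: "('k::field \<Rightarrow> 'a::ab_group_add \<Rightarrow> 'a) \<Rightarrow> ('a \<Rightarrow> 'a) \<Rightarrow>
    ('a \<Rightarrow> 'a \<Rightarrow> 'a) \<Rightarrow> ('k, 'a) tensor \<Rightarrow> ('k, 'a) tensor" where
  "map_am sc \<alpha> \<mu> = lift3 sc (\<lambda>x y z. pure sc [\<alpha> x, \<mu> y z])"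

locale hom_associative_algebra = vector_space sc
  for sc :: "'k::field \<Rightarrow> 'a::ab_group_add \<Rightarrow> 'a" +
  fixes \<alpha> :: "'a \<Rightarrow> 'a" and \<mu> :: "'a \<Rightarrow> 'a \<Rightarrow> 'a"
  assumes linear_alpha: "Vector_Spaces.linear sc sc \<alpha>"
    and linear_mult_right: "Vector_Spaces.linear sc sc (\<lambda>y. \<mu> x y)"
    and linear_mult_left: "Vector_Spaces.linear sc sc (\<lambda>x. \<mu> x y)"
    and hom_assoc: "\<mu> (\<mu> a b) (\<alpha> c) = \<mu> (\<alpha> a) (\<mu> b c)"
    and alpha_mult: "\<alpha> (\<mu> a b) = \<mu> (\<alpha> a) (\<alpha> b)"

locale hom_coassociative_coalgebra = vector_space sc
  for sc :: "'k::field \<Rightarrow> 'a::ab_group_add \<Rightarrow> 'a" +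
  fixes \<alpha> :: "'a \<Rightarrow> 'a" and \<Delta> :: "'a \<Rightarrow> ('k, 'a) tensor"
  assumes linear_twist: "Vector_Spaces.linear sc sc \<alpha>"
    and tensor_linear_comult: "tensor_linear sc 2 \<Delta>"
    and hom_coassoc: "map_Da sc \<alpha> \<Delta> (\<Delta> a) = map_aD sc \<alpha> \<Delta> (\<Delta> a)"
    and alpha_comult: "map_aa sc \<alpha> (\<Delta> a) = \<Delta> (\<alpha> a)"

text \<open>
  Both sides of the (covariant) Leibniz rules are linear maps on \<open>A \<otimes> A\<close>; as everywhere, such
  a map is given by its values on the generators \<open>a \<otimes> b\<close>.
\<close>

definition derivation :: "('k::field \<Rightarrow> 'a::ab_group_add \<Rightarrow> 'a) \<Rightarrow> ('a \<Rightarrow> 'a) \<Rightarrow>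
    ('a \<Rightarrow> 'a \<Rightarrow> 'a) \<Rightarrow> ('a \<Rightarrow> ('k, 'a) tensor) \<Rightarrow> bool" where
  "derivation sc \<alpha> \<mu> d \<longleftrightarrow> tensor_linear sc 2 d \<and>
     (\<forall>a. map_aa sc \<alpha> (d a) = d (\<alpha> a)) \<and>
     (\<forall>a b. d (\<mu> a b) = tplus sc (map_ma sc \<alpha> \<mu> (map_aD sc \<alpha> d (pure sc [a, b])))
                                 (map_am sc \<alpha> \<mu> (map_Da sc \<alpha> d (pure sc [a, b]))))"

definition covariant_derivation :: "('k::field \<Rightarrow> 'a::ab_group_add \<Rightarrow> 'a) \<Rightarrow> ('a \<Rightarrow> 'a) \<Rightarrow>
    ('a \<Rightarrow> 'a \<Rightarrow> 'a) \<Rightarrow> ('a \<Rightarrow> ('k, 'a) tensor) \<Rightarrow> ('a \<Rightarrow> ('k, 'a) tensor) \<Rightarrow>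
    ('a \<Rightarrow> ('k, 'a) tensor) \<Rightarrow> bool" where
  "covariant_derivation sc \<alpha> \<mu> \<delta>1 \<delta>2 D \<longleftrightarrow> tensor_linear sc 2 D \<and>
     (\<forall>a. map_aa sc \<alpha> (D a) = D (\<alpha> a)) \<and>
     (\<forall>a b. D (\<mu> a b) = tplus sc (map_ma sc \<alpha> \<mu> (map_aD sc \<alpha> \<delta>1 (pure sc [a, b])))
                                 (map_am sc \<alpha> \<mu> (map_Da sc \<alpha> D (pure sc [a, b])))) \<and>
     (\<forall>a b. D (\<mu> a b) = tplus sc (map_ma sc \<alpha> \<mu> (map_aD sc \<alpha> D (pure sc [a, b])))
                                 (map_am sc \<alpha> \<mu> (map_Da sc \<alpha> \<delta>2 (pure sc [a, b]))))"

locale covariant_hom_bialgebra =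
  hom_associative_algebra sc \<alpha> \<mu> + hom_coassociative_coalgebra sc \<alpha> \<Delta>
  for sc :: "'k::field \<Rightarrow> 'a::ab_group_add \<Rightarrow> 'a"
    and \<alpha> :: "'a \<Rightarrow> 'a" and \<mu> :: "'a \<Rightarrow> 'a \<Rightarrow> 'a" and \<Delta> :: "'a \<Rightarrow> ('k, 'a) tensor" +
  fixes \<delta>1 \<delta>2 :: "'a \<Rightarrow> ('k, 'a) tensor"
  assumes derivation1: "derivation sc \<alpha> \<mu> \<delta>1"
    and derivation2: "derivation sc \<alpha> \<mu> \<delta>2"
    and covariant: "covariant_derivation sc \<alpha> \<mu> \<delta>1 \<delta>2 \<Delta>"

section \<open>Actions and the elements of the third tensor power\<close>

definition alpha_invariant :: "('k::field \<Rightarrow> 'a::ab_group_add \<Rightarrow> 'a) \<Rightarrow> ('a \<Rightarrow> 'a) \<Rightarrow>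
    ('k, 'a) tensor \<Rightarrow> bool" where
  "alpha_invariant sc \<alpha> r \<longleftrightarrow> map_aa sc \<alpha> r = r"

text \<open>\<open>left_mult sc \<alpha> \<mu> a r\<close> is \<open>ar\<close>, and \<open>right_mult sc \<alpha> \<mu> r a\<close> is \<open>ra\<close>.\<close>

definition left_mult :: "('k::field \<Rightarrow> 'a::ab_group_add \<Rightarrow> 'a) \<Rightarrow> ('a \<Rightarrow> 'a) \<Rightarrow>
    ('a \<Rightarrow> 'a \<Rightarrow> 'a) \<Rightarrow> 'a \<Rightarrow> ('k, 'a) tensor \<Rightarrow> ('k, 'a) tensor" where
  "left_mult sc \<alpha> \<mu> a r = lift2 sc (\<lambda>x y. pure sc [\<mu> a x, \<alpha> y]) r"

definition right_mult :: "('k::field \<Rightarrow> 'a::ab_group_add \<Rightarrow> 'a) \<Rightarrow> ('a \<Rightarrow> 'a) \<Rightarrow>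
    ('a \<Rightarrow> 'a \<Rightarrow> 'a) \<Rightarrow> ('k, 'a) tensor \<Rightarrow> 'a \<Rightarrow> ('k, 'a) tensor" where
  "right_mult sc \<alpha> \<mu> r a = lift2 sc (\<lambda>x y. pure sc [\<alpha> x, \<mu> y a]) r"

text \<open>
  \<open>r\<^sub>1\<^sub>3s\<^sub>1\<^sub>2\<close>, \<open>r\<^sub>1\<^sub>2s\<^sub>2\<^sub>3\<close> and \<open>r\<^sub>2\<^sub>3s\<^sub>1\<^sub>3\<close>, as images of \<open>r \<otimes> s\<close> under linear maps from the fourth to the third
  tensor power; \<open>x, y\<close> are the components of \<open>r\<close> and \<open>u, v\<close> those of \<open>s\<close>.
\<close>

definition prod_13_12 :: "('k::field \<Rightarrow> 'a::ab_group_add \<Rightarrow> 'a) \<Rightarrow> ('a \<Rightarrow> 'a) \<Rightarrow>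
    ('a \<Rightarrow> 'a \<Rightarrow> 'a) \<Rightarrow> ('k, 'a) tensor \<Rightarrow> ('k, 'a) tensor \<Rightarrow> ('k, 'a) tensor" where
  "prod_13_12 sc \<alpha> \<mu> r s = lift4 sc (\<lambda>x y u v. pure sc [\<mu> x u, \<alpha> v, \<alpha> y]) (tprod sc r s)"

definition prod_12_23 :: "('k::field \<Rightarrow> 'a::ab_group_add \<Rightarrow> 'a) \<Rightarrow> ('a \<Rightarrow> 'a) \<Rightarrow>
    ('a \<Rightarrow> 'a \<Rightarrow> 'a) \<Rightarrow> ('k, 'a) tensor \<Rightarrow> ('k, 'a) tensor \<Rightarrow> ('k, 'a) tensor" where
  "prod_12_23 sc \<alpha> \<mu> r s = lift4 sc (\<lambda>x y u v. pure sc [\<alpha> x, \<mu> y u, \<alpha> v]) (tprod sc r s)"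

definition prod_23_13 :: "('k::field \<Rightarrow> 'a::ab_group_add \<Rightarrow> 'a) \<Rightarrow> ('a \<Rightarrow> 'a) \<Rightarrow>
    ('a \<Rightarrow> 'a \<Rightarrow> 'a) \<Rightarrow> ('k, 'a) tensor \<Rightarrow> ('k, 'a) tensor \<Rightarrow> ('k, 'a) tensor" where
  "prod_23_13 sc \<alpha> \<mu> r s = lift4 sc (\<lambda>x y u v. pure sc [\<alpha> u, \<alpha> x, \<mu> y v]) (tprod sc r s)"

text \<open>The actions \<open>a \<bullet> w\<close> and \<open>w \<bullet> a\<close> for \<open>w\<close> in the third tensor power:\<close>

definition left_bullet :: "('k::field \<Rightarrow> 'a::ab_group_add \<Rightarrow> 'a) \<Rightarrow> ('a \<Rightarrow> 'a) \<Rightarrow>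
    ('a \<Rightarrow> 'a \<Rightarrow> 'a) \<Rightarrow> 'a \<Rightarrow> ('k, 'a) tensor \<Rightarrow> ('k, 'a) tensor" where
  "left_bullet sc \<alpha> \<mu> a w = lift3 sc (\<lambda>x y z. pure sc [\<mu> (\<alpha> a) x, \<alpha> y, \<alpha> z]) w"

definition right_bullet :: "('k::field \<Rightarrow> 'a::ab_group_add \<Rightarrow> 'a) \<Rightarrow> ('a \<Rightarrow> 'a) \<Rightarrow>
    ('a \<Rightarrow> 'a \<Rightarrow> 'a) \<Rightarrow> ('k, 'a) tensor \<Rightarrow> 'a \<Rightarrow> ('k, 'a) tensor" where
  "right_bullet sc \<alpha> \<mu> w a = lift3 sc (\<lambda>x y z. pure sc [\<alpha> x, \<alpha> y, \<mu> z (\<alpha> a)]) w"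

end

theory Submission
  imports Defs
begin

text \<open>
  Write \<open>r = \<Sum> x\<^sub>i \<otimes> y\<^sub>i\<close> and \<open>s = \<Sum> u\<^sub>j \<otimes> v\<^sub>j\<close>. All axioms except coassociativity hold for any
  \<open>\<alpha>\<close>-invariant \<open>r\<close> and \<open>s\<close>: for \<open>E\<^sub>p\<^sub>q(a) = ap - qa\<close> the sum of
  \<open>(\<mu> \<otimes> \<alpha>)(\<alpha>(a) \<otimes> E\<^sub>p\<^sub>t(b))\<close> and \<open>(\<alpha> \<otimes> \<mu>)(E\<^sub>t\<^sub>q(a) \<otimes> \<alpha>(b))\<close> is \<open>E\<^sub>p\<^sub>q(ab)\<close> whatever \<open>t\<close> is.
  Expanding \<open>(\<triangle>' \<otimes> \<alpha>)(\<triangle>'(a)) - (\<alpha> \<otimes> \<triangle>')(\<triangle>'(a))\<close> gives eight double sums. The two that have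
  \<open>a\<close> in the middle factor cancel by Hom-associativity, and by invariance the other six are
  the terms of the difference of the two sides of the claimed identity.
\<close>

section \<open>Calculation with representatives modulo the relations\<close>

lemma tensor_eqs:
  "tplus sc (cls sc p) (cls sc q) = cls sc (p + q)"
  "tminus sc (cls sc p) (cls sc q) = cls sc (p - q)"
  "tscale sc c (cls sc p) = cls sc (fscale c p)"
  by (rule tplus_cls tminus_cls tscale_cls)+

lemma cls_diff_cong:
  "cls sc p = cls sc p' \<Longrightarrow> cls sc q = cls sc q' \<Longrightarrow> cls sc (p - q) = cls sc (p' - q')"
  by (simp flip: tminus_cls)

lemma cls_scale_cong: "cls sc p = cls sc p' \<Longrightarrow> cls sc (fscale c p) = cls sc (fscale c p')"
  by (simp flip: tscale_cls)

lemma cls_sum_cong: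
  assumes "\<And>i. i \<in> I \<Longrightarrow> cls sc (f i) = cls sc (g i)"
  shows "cls sc (\<Sum>i\<in>I. f i) = cls sc (\<Sum>i\<in>I. g i)"
  using assms free.subspace_sum[OF subspace_null_space, of I "\<lambda>i. f i - g i" sc]
  by (simp add: cls_eq_iff sum_subtractf)

text \<open>Singletons serve as cosets here because \<open>rep {p} = p\<close> holds on the nose.\<close>

definition wext :: "('a list \<Rightarrow> ('k::field, 'a) free) \<Rightarrow> ('k, 'a) free \<Rightarrow> ('k, 'a) free" where
  "wext f = free_ext (\<lambda>xs. {f xs})"

lemma linear_wext: "Vector_Spaces.linear fscale fscale (wext f)"
  unfolding wext_def by (rule free_ext_linear)

interpretation wext: Vector_Spaces.linear fscale fscale "wext f"
  for f :: "'a list \<Rightarrow> ('k::field, 'a) free"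
  by (rule linear_wext)

lemma wext_word [simp]: "wext f (word xs) = f xs"
  by (simp add: wext_def rep_def)

text \<open>Trades the chosen representatives \<open>rep (F xs)\<close> for explicit ones. Term by
  term the two differ by an element of the null space, so the class of the sum stays the
  same.\<close>

lemma lift_cls_wext:
  assumes "multilinear sc F" "\<And>xs. F xs = cls sc (f xs)"
  shows "lift sc F (cls sc p) = cls sc (wext f p)"
  unfolding lift_cls[OF assms(1)] wext_def free_ext_def
  by (intro cls_sum_cong cls_scale_cong) (simp add: assms(2) rep_def[of "{_}"] cls_rep)

section \<open>Multilinear maps on words of fixed length\<close>

lemma multilinear_case2:
  assumes "\<And>x y. F x y = cls sc (f x y)"
    and "\<And>x x' y. F (x + x') y = tplus sc (F x y) (F x' y)"
    and "\<And>x y y'. F x (y + y') = tplus sc (F x y) (F x y')"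
    and "\<And>c x y. F (sc c x) y = tscale sc c (F x y)"
    and "\<And>c x y. F x (sc c y) = tscale sc c (F x y)"
  shows "multilinear sc (\<lambda>xs. case xs of [x, y] \<Rightarrow> F x y | _ \<Rightarrow> tzero sc)"
  unfolding multilinear_def
proof (intro conjI allI)
  let ?G = "\<lambda>xs. case xs of [x, y] \<Rightarrow> F x y | _ \<Rightarrow> tzero sc"
  show "?G xs \<in> range (cls sc)" for xs
    by (auto simp: tzero_def assms(1) split: list.split)
  show "?G (us @ (x + y) # vs) = tplus sc (?G (us @ x # vs)) (?G (us @ y # vs))" for us vs x y
    \<comment> \<open>All three words have the same length. If it is 2, one of the additivity
      assumptions applies; otherwise every term is \<open>tzero\<close>. The splits only determine
      how long \<open>us\<close> and \<open>vs\<close> are.\<close>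
    by (cases us; cases "tl us"; cases "tl (tl us)";
        cases vs; cases "tl vs";
        simp add: assms(2-5) tzero_def tensor_eqs)
  show "?G (us @ sc c x # vs) = tscale sc c (?G (us @ x # vs))" for us vs c x
    by (cases us; cases "tl us"; cases "tl (tl us)";
        cases vs; cases "tl vs";
        simp add: assms(2-5) tzero_def tensor_eqs)
qed

lemma multilinear_case3:
  assumes "\<And>x y z. F x y z = cls sc (f x y z)"
    and "\<And>x x' y z. F (x + x') y z = tplus sc (F x y z) (F x' y z)"
    and "\<And>x y y' z. F x (y + y') z = tplus sc (F x y z) (F x y' z)"
    and "\<And>x y z z'. F x y (z + z') = tplus sc (F x y z) (F x y z')"
    and "\<And>c x y z. F (sc c x) y z = tscale sc c (F x y z)"
    and "\<And>c x y z. F x (sc c y) z = tscale sc c (F x y z)"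
    and "\<And>c x y z. F x y (sc c z) = tscale sc c (F x y z)"
  shows "multilinear sc (\<lambda>xs. case xs of [x, y, z] \<Rightarrow> F x y z | _ \<Rightarrow> tzero sc)"
  unfolding multilinear_def
proof (intro conjI allI)
  let ?G = "\<lambda>xs. case xs of [x, y, z] \<Rightarrow> F x y z | _ \<Rightarrow> tzero sc"
  show "?G xs \<in> range (cls sc)" for xs
    by (auto simp: tzero_def assms(1) split: list.split)
  show "?G (us @ (x + y) # vs) = tplus sc (?G (us @ x # vs)) (?G (us @ y # vs))" for us vs x y
    by (cases us; cases "tl us"; cases "tl (tl us)"; cases "tl (tl (tl us))";
        cases vs; cases "tl vs"; cases "tl (tl vs)";
        simp add: assms(2-7) tzero_def tensor_eqs)
  show "?G (us @ sc c x # vs) = tscale sc c (?G (us @ x # vs))" for us vs c x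
    by (cases us; cases "tl us"; cases "tl (tl us)"; cases "tl (tl (tl us))";
        cases vs; cases "tl vs"; cases "tl (tl vs)";
        simp add: assms(2-7) tzero_def tensor_eqs)
qed

lemma multilinear_case4:
  assumes "\<And>x y z w. F x y z w = cls sc (f x y z w)"
    and "\<And>x x' y z w. F (x + x') y z w = tplus sc (F x y z w) (F x' y z w)"
    and "\<And>x y y' z w. F x (y + y') z w = tplus sc (F x y z w) (F x y' z w)"
    and "\<And>x y z z' w. F x y (z + z') w = tplus sc (F x y z w) (F x y z' w)"
    and "\<And>x y z w w'. F x y z (w + w') = tplus sc (F x y z w) (F x y z w')"
    and "\<And>c x y z w. F (sc c x) y z w = tscale sc c (F x y z w)"
    and "\<And>c x y z w. F x (sc c y) z w = tscale sc c (F x y z w)"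
    and "\<And>c x y z w. F x y (sc c z) w = tscale sc c (F x y z w)"
    and "\<And>c x y z w. F x y z (sc c w) = tscale sc c (F x y z w)"
  shows "multilinear sc (\<lambda>xs. case xs of [x, y, z, w] \<Rightarrow> F x y z w | _ \<Rightarrow> tzero sc)"
  unfolding multilinear_def
proof (intro conjI allI)
  let ?G = "\<lambda>xs. case xs of [x, y, z, w] \<Rightarrow> F x y z w | _ \<Rightarrow> tzero sc"
  show "?G xs \<in> range (cls sc)" for xs
    by (auto simp: tzero_def assms(1) split: list.split)
  show "?G (us @ (x + y) # vs) = tplus sc (?G (us @ x # vs)) (?G (us @ y # vs))" for us vs x y
    by (cases us; cases "tl us"; cases "tl (tl us)"; cases "tl (tl (tl us))"; cases "tl (tl (tl (tl us)))";
        cases vs; cases "tl vs"; cases "tl (tl vs)"; cases "tl (tl (tl vs))";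
        simp add: assms(2-9) tzero_def tensor_eqs)
  show "?G (us @ sc c x # vs) = tscale sc c (?G (us @ x # vs))" for us vs c x
    by (cases us; cases "tl us"; cases "tl (tl us)"; cases "tl (tl (tl us))"; cases "tl (tl (tl (tl us)))";
        cases vs; cases "tl vs"; cases "tl (tl vs)"; cases "tl (tl (tl vs))";
        simp add: assms(2-9) tzero_def tensor_eqs)
qed

text \<open>The value 0 on words of other lengths represents the default \<open>tzero\<close> in
  \<open>lift2\<close>.\<close>

definition words2 :: "('a \<Rightarrow> 'a \<Rightarrow> ('k::field, 'a) free) \<Rightarrow> 'a list \<Rightarrow> ('k, 'a) free" where
  "words2 f xs = (case xs of [x, y] \<Rightarrow> f x y | _ \<Rightarrow> 0)"

definition words3 :: "('a \<Rightarrow> 'a \<Rightarrow> 'a \<Rightarrow> ('k::field, 'a) free) \<Rightarrow> 'a list \<Rightarrow> ('k, 'a) free" where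
  "words3 f xs = (case xs of [x, y, z] \<Rightarrow> f x y z | _ \<Rightarrow> 0)"

definition words4 :: "('a \<Rightarrow> 'a \<Rightarrow> 'a \<Rightarrow> 'a \<Rightarrow> ('k::field, 'a) free) \<Rightarrow> 'a list \<Rightarrow> ('k, 'a) free"
  where "words4 f xs = (case xs of [x, y, z, w] \<Rightarrow> f x y z w | _ \<Rightarrow> 0)"

lemma words_simps [simp]:
  "words2 f [x, y] = f x y"
  "words3 g [x, y, z] = g x y z"
  "words4 h [x, y, z, w] = h x y z w"
  by (simp_all add: words2_def words3_def words4_def)

text \<open>Makes \<open>lift2\<close> computable: the image of a class gets an explicit
  representative that depends linearly on \<open>p\<close>, so finite sums can be evaluated word by
  word.\<close>

lemma lift2_cls:
  assumes "\<And>x y. F x y = cls sc (f x y)"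
    and "\<And>x x' y. F (x + x') y = tplus sc (F x y) (F x' y)"
    and "\<And>x y y'. F x (y + y') = tplus sc (F x y) (F x y')"
    and "\<And>c x y. F (sc c x) y = tscale sc c (F x y)"
    and "\<And>c x y. F x (sc c y) = tscale sc c (F x y)"
  shows "lift2 sc F (cls sc p) = cls sc (wext (words2 f) p)"
  unfolding lift2_def
  by (rule lift_cls_wext[OF multilinear_case2[OF assms]])
     (auto simp: words2_def tzero_def assms(1) split: list.split)

lemma lift3_cls:
  assumes "\<And>x y z. F x y z = cls sc (f x y z)"
    and "\<And>x x' y z. F (x + x') y z = tplus sc (F x y z) (F x' y z)"
    and "\<And>x y y' z. F x (y + y') z = tplus sc (F x y z) (F x y' z)"
    and "\<And>x y z z'. F x y (z + z') = tplus sc (F x y z) (F x y z')"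
    and "\<And>c x y z. F (sc c x) y z = tscale sc c (F x y z)"
    and "\<And>c x y z. F x (sc c y) z = tscale sc c (F x y z)"
    and "\<And>c x y z. F x y (sc c z) = tscale sc c (F x y z)"
  shows "lift3 sc F (cls sc p) = cls sc (wext (words3 f) p)"
  unfolding lift3_def
  by (rule lift_cls_wext[OF multilinear_case3[OF assms]])
     (auto simp: words3_def tzero_def assms(1) split: list.split)

lemma lift4_cls:
  assumes "\<And>x y z w. F x y z w = cls sc (f x y z w)"
    and "\<And>x x' y z w. F (x + x') y z w = tplus sc (F x y z w) (F x' y z w)"
    and "\<And>x y y' z w. F x (y + y') z w = tplus sc (F x y z w) (F x y' z w)"
    and "\<And>x y z z' w. F x y (z + z') w = tplus sc (F x y z w) (F x y z' w)"
    and "\<And>x y z w w'. F x y z (w + w') = tplus sc (F x y z w) (F x y z w')"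
    and "\<And>c x y z w. F (sc c x) y z w = tscale sc c (F x y z w)"
    and "\<And>c x y z w. F x (sc c y) z w = tscale sc c (F x y z w)"
    and "\<And>c x y z w. F x y (sc c z) w = tscale sc c (F x y z w)"
    and "\<And>c x y z w. F x y z (sc c w) = tscale sc c (F x y z w)"
  shows "lift4 sc F (cls sc p) = cls sc (wext (words4 f) p)"
  unfolding lift4_def
  by (rule lift_cls_wext[OF multilinear_case4[OF assms]])
     (auto simp: words4_def tzero_def assms(1) split: list.split)

section \<open>The product of the free associative algebra as a model of the tensor product\<close>

definition conc :: "('k::field, 'a) free \<Rightarrow> ('k, 'a) free \<Rightarrow> ('k, 'a) free" where
  "conc p q = wext (\<lambda>xs. wext (\<lambda>ys. word (xs @ ys)) q) p"

lemma tprod_cls: "tprod sc (cls sc p) (cls sc q) = cls sc (conc p q)"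
  unfolding tprod_def conc_def
  by (intro lift_cls_wext multilinear_tprod multilinear_append) (simp add: pure_def)

lemma wext_pointwise_add: "wext (\<lambda>xs. f xs + g xs) p = wext f p + wext g p"
  by (simp add: wext_def free_ext_def rep_def free.scale_right_distrib sum.distrib)

lemma wext_pointwise_diff: "wext (\<lambda>xs. f xs - g xs) p = wext f p - wext g p"
  by (simp add: wext_def free_ext_def rep_def free.scale_right_diff_distrib sum_subtractf)

lemma wext_pointwise_scale: "wext (\<lambda>xs. fscale c (f xs)) p = fscale c (wext f p)"
  by (simp add: wext_def free_ext_def rep_def free.scale_sum_right mult.commute)

lemma wext_pointwise_0: "wext (\<lambda>xs. 0) p = 0"
  by (simp add: wext_def free_ext_def rep_def)

lemma wext_pointwise_sum: "wext (\<lambda>xs. \<Sum>i\<in>I. f i xs) p = (\<Sum>i\<in>I. wext (f i) p)"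
  by (induction I rule: infinite_finite_induct) (simp_all add: wext_pointwise_0 wext_pointwise_add)

lemma conc_simps:
  "conc (word xs) (word ys) = word (xs @ ys)"
  "conc (p + p') q = conc p q + conc p' q"
  "conc (p - p') q = conc p q - conc p' q"
  "conc (fscale c p) q = fscale c (conc p q)"
  "conc (\<Sum>i\<in>I. f i) q = (\<Sum>i\<in>I. conc (f i) q)"
  "conc p (q + q') = conc p q + conc p q'"
  "conc p (q - q') = conc p q - conc p q'"
  "conc p (fscale c q) = fscale c (conc p q)"
  "conc p (\<Sum>i\<in>I. f i) = (\<Sum>i\<in>I. conc p (f i))"
  by (simp_all add: conc_def wext.add wext.diff wext.scale wext.sum wext_pointwise_add
      wext_pointwise_diff wext_pointwise_scale wext_pointwise_sum)

lemma conc_sum_word: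
  "conc (\<Sum>i\<in>I. word (w i)) (\<Sum>j\<in>J. word (w' j)) = (\<Sum>i\<in>I. \<Sum>j\<in>J. word (w i @ w' j))"
  \<comment> \<open>Expanding the left factor first makes the sum over \<open>I\<close> the outer
    one.\<close>
  by (simp only: conc_simps(5)) (simp only: conc_simps(9) conc_simps(1))

section \<open>Elementary tensors and sums of them\<close>

lemma pure2_add:
  "pure sc [x + x', y] = tplus sc (pure sc [x, y]) (pure sc [x', y])"
  "pure sc [x, y + y'] = tplus sc (pure sc [x, y]) (pure sc [x, y'])"
  using pure_add[of sc "[]" _ _ "[_]"] pure_add[of sc "[_]" _ _ "[]"] by simp_all

lemma pure2_scale:
  "pure sc [sc c x, y] = tscale sc c (pure sc [x, y])"
  "pure sc [x, sc c y] = tscale sc c (pure sc [x, y])"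
  using pure_scale[of sc "[]" _ _ "[_]"] pure_scale[of sc "[_]" _ _ "[]"] by simp_all

lemma pure3_add:
  "pure sc [x + x', y, z] = tplus sc (pure sc [x, y, z]) (pure sc [x', y, z])"
  "pure sc [x, y + y', z] = tplus sc (pure sc [x, y, z]) (pure sc [x, y', z])"
  "pure sc [x, y, z + z'] = tplus sc (pure sc [x, y, z]) (pure sc [x, y, z'])"
  using pure_add[of sc "[]" _ _ "[_, _]"] pure_add[of sc "[_]" _ _ "[_]"]
    pure_add[of sc "[_, _]" _ _ "[]"] by simp_all

lemma pure3_scale:
  "pure sc [sc c x, y, z] = tscale sc c (pure sc [x, y, z])"
  "pure sc [x, sc c y, z] = tscale sc c (pure sc [x, y, z])"
  "pure sc [x, y, sc c z] = tscale sc c (pure sc [x, y, z])"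
  using pure_scale[of sc "[]" _ _ "[_, _]"] pure_scale[of sc "[_]" _ _ "[_]"]
    pure_scale[of sc "[_, _]" _ _ "[]"] by simp_all

lemma cls_sum_in_tensor_power:
  fixes sc :: "'k::field \<Rightarrow> 'a::ab_group_add \<Rightarrow> 'a"
  assumes "\<And>i. i \<in> I \<Longrightarrow> length (w i) = n" "\<And>j. j \<in> J \<Longrightarrow> length (w' j) = n"
  shows "cls sc ((\<Sum>i\<in>I. word (w i)) - (\<Sum>j\<in>J. word (w' j))) \<in> tensor_power sc n"
proof -
  have sub: "free.subspace {p :: ('k, 'a) free. \<forall>xs \<in> Poly_Mapping.keys p. length xs = n}"
    by (force simp: free.subspace_def in_keys_iff lookup_add)
  have "(\<Sum>i\<in>I. word (w i)) - (\<Sum>j\<in>J. word (w' j))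
      \<in> {p :: ('k, 'a) free. \<forall>xs \<in> Poly_Mapping.keys p. length xs = n}"
    using assms
    by (intro free.subspace_diff[OF sub] free.subspace_sum[OF sub]) (auto simp: word_def)
  then show ?thesis unfolding tensor_power_def by blast
qed

text \<open>The coefficient of each word is absorbed into its first letter. This changes the
  representative but not its class, and keeps scalars out of all later double sums.\<close>

lemma tensor_power_2E:
  fixes sc :: "'k::field \<Rightarrow> 'a::ab_group_add \<Rightarrow> 'a"
  assumes "r \<in> tensor_power sc 2"
  obtains I :: "'a list set" and x y where "r = cls sc (\<Sum>i\<in>I. word [x i, y i])"
proof -
  obtain p where p: "r = cls sc p" "\<And>xs. xs \<in> Poly_Mapping.keys p \<Longrightarrow> length xs = 2"
    using assms unfolding tensor_power_def by auto
  let ?c = "Poly_Mapping.lookup p"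
  have "p = (\<Sum>xs\<in>Poly_Mapping.keys p. fscale (?c xs) (word xs))"
    by (intro poly_mapping_eqI)
       (simp add: lookup_sum word_def lookup_single when_def in_keys_iff
        if_distrib[of "(*) _"] cong: if_cong)
  then have "r = cls sc (\<Sum>xs\<in>Poly_Mapping.keys p. fscale (?c xs) (word xs))"
    using p(1) by simp
  also have "\<dots> = cls sc (\<Sum>xs\<in>Poly_Mapping.keys p. word [sc (?c xs) (xs ! 0), xs ! 1])"
  proof (rule cls_sum_cong)
    fix xs assume "xs \<in> Poly_Mapping.keys p"
    then have "xs = [xs ! 0, xs ! 1]"
      using p(2)[of xs] by (auto simp: length_Suc_conv numeral_2_eq_2)
    then show "cls sc (fscale (?c xs) (word xs)) = cls sc (word [sc (?c xs) (xs ! 0), xs ! 1])"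
      using pure2_scale(1)[of sc "?c xs" "xs ! 0" "xs ! 1"] by (simp add: pure_def tscale_cls)
  qed
  finally show thesis by (rule that)
qed

section \<open>Structure maps of a Hom-associative algebra on representatives\<close>

context hom_associative_algebra
begin

lemma linear_simps:
  "\<alpha> (x + y) = \<alpha> x + \<alpha> y" "\<alpha> (sc c x) = sc c (\<alpha> x)"
  "\<mu> (x + y) z = \<mu> x z + \<mu> y z" "\<mu> z (x + y) = \<mu> z x + \<mu> z y"
  "\<mu> (sc c x) z = sc c (\<mu> x z)" "\<mu> z (sc c x) = sc c (\<mu> z x)"
  using linear_alpha linear_mult_left linear_mult_right
  by (simp_all add: Vector_Spaces.linear_iff)

lemmas pure_simps = pure2_add pure2_scale pure3_add pure3_scale linear_simps

lemma left_mult_cls: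
  "left_mult sc \<alpha> \<mu> a (cls sc p) = cls sc (wext (words2 (\<lambda>x y. word [\<mu> a x, \<alpha> y])) p)"
  \<comment> \<open>The multilinearity goals are solved while \<open>pure\<close> is still folded;
    only the goal about the representative needs its definition.\<close>
  unfolding left_mult_def by (rule lift2_cls) (simp_all add: pure_simps, simp add: pure_def)

lemma right_mult_cls:
  "right_mult sc \<alpha> \<mu> (cls sc p) a = cls sc (wext (words2 (\<lambda>x y. word [\<alpha> x, \<mu> y a])) p)"
  unfolding right_mult_def by (rule lift2_cls) (simp_all add: pure_simps, simp add: pure_def)

lemma map_aa_cls:
  "map_aa sc \<alpha> (cls sc p) = cls sc (wext (words2 (\<lambda>x y. word [\<alpha> x, \<alpha> y])) p)"
  unfolding map_aa_def by (rule lift2_cls) (simp_all add: pure_simps, simp add: pure_def)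

lemma map_ma_cls:
  "map_ma sc \<alpha> \<mu> (cls sc p) = cls sc (wext (words3 (\<lambda>x y z. word [\<mu> x y, \<alpha> z])) p)"
  unfolding map_ma_def by (rule lift3_cls) (simp_all add: pure_simps, simp add: pure_def)

lemma map_am_cls:
  "map_am sc \<alpha> \<mu> (cls sc p) = cls sc (wext (words3 (\<lambda>x y z. word [\<alpha> x, \<mu> y z])) p)"
  unfolding map_am_def by (rule lift3_cls) (simp_all add: pure_simps, simp add: pure_def)

lemma left_bullet_cls:
  "left_bullet sc \<alpha> \<mu> a (cls sc p)
    = cls sc (wext (words3 (\<lambda>x y z. word [\<mu> (\<alpha> a) x, \<alpha> y, \<alpha> z])) p)"
  unfolding left_bullet_def by (rule lift3_cls) (simp_all add: pure_simps, simp add: pure_def)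

lemma right_bullet_cls:
  "right_bullet sc \<alpha> \<mu> (cls sc p) a
    = cls sc (wext (words3 (\<lambda>x y z. word [\<alpha> x, \<alpha> y, \<mu> z (\<alpha> a)])) p)"
  unfolding right_bullet_def by (rule lift3_cls) (simp_all add: pure_simps, simp add: pure_def)

lemma prod_13_12_cls:
  "prod_13_12 sc \<alpha> \<mu> (cls sc p) (cls sc q)
    = cls sc (wext (words4 (\<lambda>x y u v. word [\<mu> x u, \<alpha> v, \<alpha> y])) (conc p q))"
  unfolding prod_13_12_def tprod_cls
  by (rule lift4_cls) (simp_all add: pure_simps, simp add: pure_def)

lemma prod_12_23_cls:
  "prod_12_23 sc \<alpha> \<mu> (cls sc p) (cls sc q)
    = cls sc (wext (words4 (\<lambda>x y u v. word [\<alpha> x, \<mu> y u, \<alpha> v])) (conc p q))"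
  unfolding prod_12_23_def tprod_cls
  by (rule lift4_cls) (simp_all add: pure_simps, simp add: pure_def)

lemma prod_23_13_cls:
  "prod_23_13 sc \<alpha> \<mu> (cls sc p) (cls sc q)
    = cls sc (wext (words4 (\<lambda>x y u v. word [\<alpha> u, \<alpha> x, \<mu> y v])) (conc p q))"
  unfolding prod_23_13_def tprod_cls
  by (rule lift4_cls) (simp_all add: pure_simps, simp add: pure_def)

text \<open>For the factor \<alpha> of \<open>map_Da\<close> and \<open>map_aD\<close>, which enters
  as a tensor of degree one.\<close>

lemma cls_word_alpha:
  "cls sc (word [\<alpha> (x + y)]) = cls sc (word [\<alpha> x] + word [\<alpha> y])"
  "cls sc (word [\<alpha> (sc c x)]) = cls sc (fscale c (word [\<alpha> x]))"
  using pure_add[of sc "[]" "\<alpha> x" "\<alpha> y" "[]"] pure_scale[of sc "[]" c "\<alpha> x" "[]"]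
  by (simp_all add: pure_def tensor_eqs linear_simps)

text \<open>The representatives \<open>d x\<close> depend linearly on \<open>x\<close> only modulo
  the relations, so linearity is assumed of \<open>D\<close>. Accordingly sums and multiples inside
  \<open>D\<close> are resolved before \<open>D\<close> is replaced by \<open>d\<close>.\<close>

lemma map_Da_cls:
  assumes "tensor_linear sc n D" and D: "\<And>x. D x = cls sc (d x)"
  shows "map_Da sc \<alpha> D (cls sc p) = cls sc (wext (words2 (\<lambda>x y. conc (d x) (word [\<alpha> y]))) p)"
proof -
  have "D (x + y) = cls sc (d x + d y)" "D (sc c x) = cls sc (fscale c (d x))" for x y c
    using assms(1) by (simp_all add: tensor_linear_def D tensor_eqs)
  then show ?thesis
    unfolding map_Da_def pure_def
    by (intro lift2_cls)
       (simp_all only: cls_word_alpha D[symmetric], simp_all only: D tprod_cls conc_simps tensor_eqs)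
qed

lemma map_aD_cls:
  assumes "tensor_linear sc n D" and D: "\<And>x. D x = cls sc (d x)"
  shows "map_aD sc \<alpha> D (cls sc p) = cls sc (wext (words2 (\<lambda>x y. conc (word [\<alpha> x]) (d y))) p)"
proof -
  have "D (x + y) = cls sc (d x + d y)" "D (sc c x) = cls sc (fscale c (d x))" for x y c
    using assms(1) by (simp_all add: tensor_linear_def D tensor_eqs)
  then show ?thesis
    unfolding map_aD_def pure_def
    by (intro lift2_cls)
       (simp_all only: cls_word_alpha D[symmetric], simp_all only: D tprod_cls conc_simps tensor_eqs)
qed

section \<open>The maps \<open>E\<^sub>p\<^sub>q\<close> and their Leibniz rules\<close>

definition inner2 :: "('k, 'a) free \<Rightarrow> ('k, 'a) free \<Rightarrow> 'a \<Rightarrow> ('k, 'a) free" where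
  "inner2 p q a = wext (words2 (\<lambda>x y. word [\<mu> a x, \<alpha> y])) p
                - wext (words2 (\<lambda>x y. word [\<alpha> x, \<mu> y a])) q"

text \<open>Shows that \<open>inner2 p q a\<close> represents \<open>E\<^sub>p\<^sub>q(a)\<close>.
  With \<open>p\<close> representing \<open>r\<close> and \<open>q\<close> representing
  \<open>s\<close>, the pairs \<open>(p, q)\<close>, \<open>(p, p)\<close> and \<open>(q, q)\<close>
  give the three maps of the theorem.\<close>

lemma inner2_cls:
  "tminus sc (left_mult sc \<alpha> \<mu> a (cls sc p)) (right_mult sc \<alpha> \<mu> (cls sc q) a)
    = cls sc (inner2 p q a)"
  by (simp add: inner2_def left_mult_cls right_mult_cls tminus_cls)

lemma inner2_sum:
  "inner2 (\<Sum>i\<in>I. word [x i, y i]) (\<Sum>j\<in>J. word [u j, v j]) a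
    = (\<Sum>i\<in>I. word [\<mu> a (x i), \<alpha> (y i)]) - (\<Sum>j\<in>J. word [\<alpha> (u j), \<mu> (v j) a])"
  by (simp add: inner2_def wext.sum)

lemmas cls_word_simps = pure2_add[unfolded pure_def tensor_eqs]
  pure2_scale[unfolded pure_def tensor_eqs] pure3_add[unfolded pure_def tensor_eqs]
  pure3_scale[unfolded pure_def tensor_eqs] linear_simps tensor_eqs

lemma tensor_linear_inner2:
  "tensor_linear sc 2
     (\<lambda>a. cls sc (inner2 (\<Sum>i\<in>I. word [x i, y i]) (\<Sum>j\<in>J. word [u j, v j]) a))"
proof -
  let ?f = "\<lambda>a i. word [\<mu> a (x i), \<alpha> (y i)]" and ?g = "\<lambda>a j. word [\<alpha> (u j), \<mu> (v j) a]"
  have "cls sc (sum (?f (a + b)) I - sum (?g (a + b)) J)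
      = cls sc ((\<Sum>i\<in>I. ?f a i + ?f b i) - (\<Sum>j\<in>J. ?g a j + ?g b j))" for a b
    \<comment> \<open>Each word splits only modulo the relations, so the terms are rewritten under
      \<open>cls\<close>; the sums are separated afterwards by \<open>sum.distrib\<close>.\<close>
    by (intro cls_diff_cong cls_sum_cong) (simp_all add: cls_word_simps)
  moreover have "cls sc (sum (?f (sc c a)) I - sum (?g (sc c a)) J)
      = cls sc ((\<Sum>i\<in>I. fscale c (?f a i)) - (\<Sum>j\<in>J. fscale c (?g a j)))" for a c
    by (intro cls_diff_cong cls_sum_cong) (simp_all add: cls_word_simps)
  ultimately show ?thesis
    by (simp add: tensor_linear_def inner2_sum cls_sum_in_tensor_power tensor_eqs sum.distrib
        free.scale_sum_right free.scale_right_diff_distrib algebra_simps)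
qed

text \<open>Being bilinear modulo the relations, \<open>g\<close> induces a linear map on the second
  tensor power; applying it to the two sides of the invariance equation gives the claim. All later
  uses of invariance go through this lemma, which puts \<alpha> on both letters of one copy.\<close>

lemma alpha_invariant_sum:
  assumes inv: "alpha_invariant sc \<alpha> (cls sc (\<Sum>i\<in>I. word [x i, y i]))"
    and "\<And>b b' c. cls sc (g (b + b') c) = cls sc (g b c + g b' c)"
    and "\<And>b c c'. cls sc (g b (c + c')) = cls sc (g b c + g b c')"
    and "\<And>k b c. cls sc (g (sc k b) c) = cls sc (fscale k (g b c))"
    and "\<And>k b c. cls sc (g b (sc k c)) = cls sc (fscale k (g b c))"
  shows "cls sc (\<Sum>i\<in>I. g (x i) (y i)) = cls sc (\<Sum>i\<in>I. g (\<alpha> (x i)) (\<alpha> (y i)))"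
proof -
  have lift: "lift2 sc (\<lambda>b c. cls sc (g b c)) (cls sc p) = cls sc (wext (words2 g) p)" for p
    by (rule lift2_cls) (simp_all add: assms(2-5) tensor_eqs)
  have "cls sc (\<Sum>i\<in>I. word [\<alpha> (x i), \<alpha> (y i)])
      = cls sc (\<Sum>i\<in>I. word [x i, y i])"
    using inv by (simp add: alpha_invariant_def map_aa_cls wext.sum)
  from arg_cong[OF this, of "lift2 sc (\<lambda>b c. cls sc (g b c))"] show ?thesis
    by (simp add: lift wext.sum)
qed

text \<open>Once invariance has put \<alpha> on both letters of \<open>p\<close> and of
  \<open>q\<close>, the two sides agree because \<alpha> is multiplicative.\<close>

lemma inner2_alpha:
  assumes p: "p = (\<Sum>i\<in>I. word [x i, y i])" and q: "q = (\<Sum>j\<in>J. word [u j, v j])"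
    and inv: "alpha_invariant sc \<alpha> (cls sc p)" "alpha_invariant sc \<alpha> (cls sc q)"
  shows "map_aa sc \<alpha> (cls sc (inner2 p q a)) = cls sc (inner2 p q (\<alpha> a))"
proof -
  have "cls sc (inner2 p q (\<alpha> a))
      = cls sc ((\<Sum>i\<in>I. word [\<mu> (\<alpha> a) (\<alpha> (x i)), \<alpha> (\<alpha> (y i))])
              - (\<Sum>j\<in>J. word [\<alpha> (\<alpha> (u j)), \<mu> (\<alpha> (v j)) (\<alpha> a)]))"
    unfolding p q inner2_sum
    by (intro cls_diff_cong alpha_invariant_sum[OF inv(1)[unfolded p]]
        alpha_invariant_sum[OF inv(2)[unfolded q]]) (simp_all add: cls_word_simps)
  then show ?thesis
    by (simp add: p q inner2_sum map_aa_cls wext.sum wext.diff alpha_mult)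
qed

text \<open>Covers all four Leibniz rules: \<open>p = q = t\<close> gives those of the derivations,
  and \<open>t = p\<close> and \<open>t = q\<close> give the two rules of the covariant
  derivation.\<close>

lemma inner2_Leibniz:
  assumes p: "p = (\<Sum>i\<in>I. word [x i, y i])" and q: "q = (\<Sum>j\<in>J. word [u j, v j])"
    and t: "t = (\<Sum>k\<in>K. word [z k, w k])"
    and inv: "alpha_invariant sc \<alpha> (cls sc p)" "alpha_invariant sc \<alpha> (cls sc q)"
  shows "cls sc (inner2 p q (\<mu> a b)) =
      tplus sc (map_ma sc \<alpha> \<mu> (map_aD sc \<alpha> (\<lambda>c. cls sc (inner2 p t c)) (pure sc [a, b])))
               (map_am sc \<alpha> \<mu> (map_Da sc \<alpha> (\<lambda>c. cls sc (inner2 t q c)) (pure sc [a, b])))"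
proof -
  have lin_pt: "tensor_linear sc 2 (\<lambda>c. cls sc (inner2 p t c))"
    unfolding p t by (rule tensor_linear_inner2)
  have lin_tq: "tensor_linear sc 2 (\<lambda>c. cls sc (inner2 t q c))"
    unfolding t q by (rule tensor_linear_inner2)
  have "cls sc (inner2 p q (\<mu> a b))
      = cls sc ((\<Sum>i\<in>I. word [\<mu> (\<mu> a b) (\<alpha> (x i)), \<alpha> (\<alpha> (y i))])
              - (\<Sum>j\<in>J. word [\<alpha> (\<alpha> (u j)), \<mu> (\<alpha> (v j)) (\<mu> a b)]))"
    unfolding p q inner2_sum
    by (intro cls_diff_cong alpha_invariant_sum[OF inv(1)[unfolded p]]
        alpha_invariant_sum[OF inv(2)[unfolded q]]) (simp_all add: cls_word_simps)
  \<comment> \<open>The two sums over \<open>K\<close> cancel because \<alpha> is multiplicative;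
    Hom-associativity rebrackets the sums over \<open>I\<close> and \<open>J\<close>.\<close>
  also have "\<dots> = cls sc
      ((\<Sum>i\<in>I. word [\<mu> (\<alpha> a) (\<mu> b (x i)), \<alpha> (\<alpha> (y i))])
        - (\<Sum>k\<in>K. word [\<mu> (\<alpha> a) (\<alpha> (z k)), \<alpha> (\<mu> (w k) b)])
      + ((\<Sum>k\<in>K. word [\<alpha> (\<mu> a (z k)), \<mu> (\<alpha> (w k)) (\<alpha> b)])
        - (\<Sum>j\<in>J. word [\<alpha> (\<alpha> (u j)), \<mu> (\<mu> (v j) a) (\<alpha> b)])))"
    by (simp add: alpha_mult) (simp add: hom_assoc)
  finally show ?thesis
    unfolding pure_def map_aD_cls[OF lin_pt refl] map_Da_cls[OF lin_tq refl]
    by (simp add: p q t inner2_sum conc_simps map_ma_cls map_am_cls wext.sum wext.diff tplus_cls)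
qed

section \<open>Hom-coassociativity in terms of the elements of the third tensor power\<close>

lemma coassoc_iff:
  assumes p: "p = (\<Sum>i\<in>I. word [x i, y i])" and q: "q = (\<Sum>j\<in>J. word [u j, v j])"
    and invp: "alpha_invariant sc \<alpha> (cls sc p)" and invq: "alpha_invariant sc \<alpha> (cls sc q)"
  defines "r \<equiv> cls sc p" and "s \<equiv> cls sc q" and "\<Delta> \<equiv> \<lambda>c. cls sc (inner2 p q c)"
  shows "map_Da sc \<alpha> \<Delta> (\<Delta> a) = map_aD sc \<alpha> \<Delta> (\<Delta> a) \<longleftrightarrow>
      left_bullet sc \<alpha> \<mu> a
        (tplus sc (tminus sc (prod_13_12 sc \<alpha> \<mu> r r) (prod_12_23 sc \<alpha> \<mu> r r))
                  (prod_23_13 sc \<alpha> \<mu> s r))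
      = right_bullet sc \<alpha> \<mu>
        (tplus sc (tminus sc (prod_13_12 sc \<alpha> \<mu> s r) (prod_12_23 sc \<alpha> \<mu> s s))
                  (prod_23_13 sc \<alpha> \<mu> s s)) a"
proof -
  note invr = alpha_invariant_sum[OF invp[unfolded p]]
  note invs = alpha_invariant_sum[OF invq[unfolded q]]
  \<comment> \<open>\<open>L1\<close>, \<open>L2\<close>, \<open>L3\<close> come from the three
    products on the left of the claimed identity, in order, and \<open>R1\<close>,
    \<open>R2\<close>, \<open>R3\<close> from those on the right. \<open>M\<close> is the common
    value of the two sums with \<open>a\<close> in the middle factor.\<close>
  define L1 :: "('k, 'a) free" where
    "L1 = (\<Sum>i\<in>I. \<Sum>k\<in>I. word [\<mu> (\<alpha> a) (\<mu> (x i) (x k)), \<alpha> (\<alpha> (y k)), \<alpha> (\<alpha> (y i))])"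
  define L2 :: "('k, 'a) free" where
    "L2 = (\<Sum>i\<in>I. \<Sum>k\<in>I. word [\<mu> (\<alpha> a) (\<alpha> (x i)), \<alpha> (\<mu> (y i) (x k)), \<alpha> (\<alpha> (y k))])"
  define L3 :: "('k, 'a) free" where
    "L3 = (\<Sum>j\<in>J. \<Sum>i\<in>I. word [\<mu> (\<alpha> a) (\<alpha> (x i)), \<alpha> (\<alpha> (u j)), \<alpha> (\<mu> (v j) (y i))])"
  define R1 :: "('k, 'a) free" where
    "R1 = (\<Sum>j\<in>J. \<Sum>i\<in>I. word [\<alpha> (\<mu> (u j) (x i)), \<alpha> (\<alpha> (y i)), \<mu> (\<alpha> (v j)) (\<alpha> a)])"
  define R2 :: "('k, 'a) free" where
    "R2 = (\<Sum>j\<in>J. \<Sum>k\<in>J. word [\<alpha> (\<alpha> (u j)), \<alpha> (\<mu> (v j) (u k)), \<mu> (\<alpha> (v k)) (\<alpha> a)])"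
  define R3 :: "('k, 'a) free" where
    "R3 = (\<Sum>j\<in>J. \<Sum>k\<in>J. word [\<alpha> (\<alpha> (u k)), \<alpha> (\<alpha> (u j)), \<mu> (\<mu> (v j) (v k)) (\<alpha> a)])"
  define M :: "('k, 'a) free" where
    "M = (\<Sum>i\<in>I. \<Sum>j\<in>J. word [\<alpha> (\<alpha> (u j)), \<mu> (\<alpha> (v j)) (\<mu> a (x i)), \<alpha> (\<alpha> (y i))])"
  note defs = L1_def L2_def L3_def R1_def R2_def R3_def M_def

  have left: "left_bullet sc \<alpha> \<mu> a
        (tplus sc (tminus sc (prod_13_12 sc \<alpha> \<mu> r r) (prod_12_23 sc \<alpha> \<mu> r r))
                  (prod_23_13 sc \<alpha> \<mu> s r)) = cls sc (L1 - L2 + L3)"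
    by (simp add: r_def s_def p q defs prod_13_12_cls prod_12_23_cls prod_23_13_cls conc_sum_word
        wext.sum wext.diff wext.add tensor_eqs left_bullet_cls)
  have right: "right_bullet sc \<alpha> \<mu>
        (tplus sc (tminus sc (prod_13_12 sc \<alpha> \<mu> s r) (prod_12_23 sc \<alpha> \<mu> s s))
                  (prod_23_13 sc \<alpha> \<mu> s s)) a = cls sc (R1 - R2 + R3)"
    by (simp add: r_def s_def p q defs prod_13_12_cls prod_12_23_cls prod_23_13_cls conc_sum_word
        wext.sum wext.diff wext.add tensor_eqs right_bullet_cls)

  \<comment> \<open>Each of the next eight facts uses invariance for one of the two copies. Since
    \<open>alpha_invariant_sum\<close> is applied to the inner sum, \<open>sum.swap\<close> comes
    first whenever that copy has the outer index in the definition of the target.\<close>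
  have l1: "cls sc (\<Sum>i\<in>I. \<Sum>k\<in>I. word [\<mu> (\<mu> a (x i)) (x k), \<alpha> (y k), \<alpha> (\<alpha> (y i))])
      = cls sc L1"
    unfolding L1_def hom_assoc[symmetric]
    by (intro cls_sum_cong invr) (simp_all add: cls_word_simps)
  have l2: "cls sc (\<Sum>i\<in>I. \<Sum>k\<in>I. word [\<alpha> (\<mu> a (x i)), \<mu> (\<alpha> (y i)) (x k), \<alpha> (y k)])
      = cls sc L2"
    unfolding L2_def alpha_mult
    by (intro cls_sum_cong invr) (simp_all add: cls_word_simps)
  have l3: "cls sc (\<Sum>i\<in>I. \<Sum>j\<in>J. word [\<alpha> (\<mu> a (x i)), \<alpha> (u j), \<mu> (v j) (\<alpha> (y i))])
      = cls sc L3"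
    unfolding L3_def alpha_mult sum.swap[of _ I J]
    by (intro cls_sum_cong invs) (simp_all add: cls_word_simps)
  have r1: "cls sc (\<Sum>j\<in>J. \<Sum>i\<in>I. word [\<mu> (\<alpha> (u j)) (x i), \<alpha> (y i), \<alpha> (\<mu> (v j) a)])
      = cls sc R1"
    unfolding R1_def alpha_mult
    by (intro cls_sum_cong invr) (simp_all add: cls_word_simps)
  have r2: "cls sc (\<Sum>j\<in>J. \<Sum>k\<in>J. word [\<alpha> (u k), \<mu> (v k) (\<alpha> (u j)), \<alpha> (\<mu> (v j) a)])
      = cls sc R2"
  proof -
    have "R2 = (\<Sum>j\<in>J. \<Sum>k\<in>J. word [\<alpha> (\<alpha> (u k)), \<mu> (\<alpha> (v k)) (\<alpha> (u j)), \<alpha> (\<mu> (v j) a)])"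
      unfolding R2_def alpha_mult by (rule sum.swap)
    then show ?thesis
      by (simp only:) (intro cls_sum_cong invs, simp_all add: cls_word_simps)
  qed
  have r3: "cls sc (\<Sum>j\<in>J. \<Sum>k\<in>J. word [\<alpha> (\<alpha> (u j)), \<alpha> (u k), \<mu> (v k) (\<mu> (v j) a)])
      = cls sc R3"
  proof -
    have "R3 = (\<Sum>j\<in>J. \<Sum>k\<in>J. word [\<alpha> (\<alpha> (u j)), \<alpha> (\<alpha> (u k)), \<mu> (\<alpha> (v k)) (\<mu> (v j) a)])"
      unfolding R3_def hom_assoc by (rule sum.swap)
    then show ?thesis
      by (simp only:) (intro cls_sum_cong invs, simp_all add: cls_word_simps)
  qed
  have m1: "cls sc (\<Sum>i\<in>I. \<Sum>j\<in>J. word [\<alpha> (u j), \<mu> (v j) (\<mu> a (x i)), \<alpha> (\<alpha> (y i))])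
      = cls sc M"
    unfolding M_def by (intro cls_sum_cong invs) (simp_all add: cls_word_simps)
  \<comment> \<open>Here Hom-associativity turns the middle factor of \<open>M\<close> into
    \<open>\<mu> (\<mu> (v j) a) (\<alpha> (x i))\<close>, so that now \<open>r\<close> is the copy
    carrying the extra \<alpha>.\<close>
  have m2: "cls sc (\<Sum>j\<in>J. \<Sum>i\<in>I. word [\<alpha> (\<alpha> (u j)), \<mu> (\<mu> (v j) a) (x i), \<alpha> (y i)])
      = cls sc M"
    unfolding M_def hom_assoc[symmetric] sum.swap[of _ J I]
    by (intro cls_sum_cong invr) (simp_all add: cls_word_simps)

  have linear: "tensor_linear sc 2 (\<lambda>c. cls sc (inner2 p q c))"
    unfolding p q by (rule tensor_linear_inner2)
  \<comment> \<open>The part \<open>ar\<close> of \<open>\<Delta> a\<close> contributes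
    \<open>L1 - M\<close>, and the part \<open>sa\<close> contributes \<open>R1 - R2\<close>. On the
    other side these parts contribute \<open>L2 - L3\<close> and \<open>M - R3\<close>.\<close>
  have "map_Da sc \<alpha> \<Delta> (\<Delta> a) = cls sc (L1 - M - (R1 - R2))"
    unfolding \<Delta>_def map_Da_cls[OF linear refl]
    by (simp add: p q inner2_sum conc_simps wext.sum wext.diff sum_subtractf)
       (intro cls_diff_cong l1 m1 r1 r2)
  moreover have "map_aD sc \<alpha> \<Delta> (\<Delta> a) = cls sc (L2 - L3 - (M - R3))"
    unfolding \<Delta>_def map_aD_cls[OF linear refl]
    by (simp add: p q inner2_sum conc_simps wext.sum wext.diff sum_subtractf)
       (intro cls_diff_cong l2 l3 m2 r3)
  ultimately show ?thesis
    unfolding left right by (simp add: cls_eq_iff algebra_simps)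
qed

end

section \<open>Reduction of the bialgebra axioms to Hom-coassociativity\<close>

theorem theorem5p7:
  fixes sc :: "'k::field \<Rightarrow> 'a::ab_group_add \<Rightarrow> 'a"
    and \<alpha> :: "'a \<Rightarrow> 'a" and \<mu> :: "'a \<Rightarrow> 'a \<Rightarrow> 'a"
    and r s :: "('k, 'a) tensor"
  assumes "hom_associative_algebra sc \<alpha> \<mu>"
    and "r \<in> tensor_power sc 2" and "s \<in> tensor_power sc 2"
    and "alpha_invariant sc \<alpha> r" and "alpha_invariant sc \<alpha> s"
  shows "covariant_hom_bialgebra sc \<alpha> \<mu>
      (\<lambda>a. tminus sc (left_mult sc \<alpha> \<mu> a r) (right_mult sc \<alpha> \<mu> s a))
      (\<lambda>a. tminus sc (left_mult sc \<alpha> \<mu> a r) (right_mult sc \<alpha> \<mu> r a))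
      (\<lambda>a. tminus sc (left_mult sc \<alpha> \<mu> a s) (right_mult sc \<alpha> \<mu> s a))
    \<longleftrightarrow> (\<forall>a.
      left_bullet sc \<alpha> \<mu> a
        (tplus sc (tminus sc (prod_13_12 sc \<alpha> \<mu> r r) (prod_12_23 sc \<alpha> \<mu> r r))
                  (prod_23_13 sc \<alpha> \<mu> s r))
      = right_bullet sc \<alpha> \<mu>
        (tplus sc (tminus sc (prod_13_12 sc \<alpha> \<mu> s r) (prod_12_23 sc \<alpha> \<mu> s s))
                  (prod_23_13 sc \<alpha> \<mu> s s)) a)"
proof -
  interpret hom_associative_algebra sc \<alpha> \<mu> by fact
  obtain I :: "'a list set" and x y where r: "r = cls sc (\<Sum>i\<in>I. word [x i, y i])"
    using assms(2) by (rule tensor_power_2E)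
  obtain J :: "'a list set" and u v where s: "s = cls sc (\<Sum>j\<in>J. word [u j, v j])"
    using assms(3) by (rule tensor_power_2E)
  define p where p: "p = (\<Sum>i\<in>I. word [x i, y i] :: ('k, 'a) free)"
  define q where q: "q = (\<Sum>j\<in>J. word [u j, v j] :: ('k, 'a) free)"
  note rs = r[folded p] s[folded q]
  note inv = assms(4,5)[unfolded rs]
  note lin = tensor_linear_inner2[where I = I and x = x and y = y, folded p]
    tensor_linear_inner2[where J = J and u = u and v = v, folded q]
  have "derivation sc \<alpha> \<mu> (\<lambda>c. cls sc (inner2 p p c))"
    unfolding derivation_def
    by (intro conjI allI lin(1)[where J = I and u = x and v = y, folded p]
        inner2_alpha[OF p p inv(1) inv(1)] inner2_Leibniz[OF p p p inv(1) inv(1)])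
  moreover have "derivation sc \<alpha> \<mu> (\<lambda>c. cls sc (inner2 q q c))"
    unfolding derivation_def
    by (intro conjI allI lin(2)[where I = J and x = u and y = v, folded q]
        inner2_alpha[OF q q inv(2) inv(2)] inner2_Leibniz[OF q q q inv(2) inv(2)])
  moreover have linear: "tensor_linear sc 2 (\<lambda>c. cls sc (inner2 p q c))"
    by (rule lin(1)[where J = J and u = u and v = v, folded q])
  moreover have "covariant_derivation sc \<alpha> \<mu> (\<lambda>c. cls sc (inner2 p p c))
      (\<lambda>c. cls sc (inner2 q q c)) (\<lambda>c. cls sc (inner2 p q c))"
    unfolding covariant_derivation_def
    \<comment> \<open>The auxiliary tensor is \<open>p\<close> for the rule with the first
      derivation on the right factor and \<open>q\<close> for the rule with the second on the left
      factor.\<close>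
    by (intro conjI allI linear inner2_alpha[OF p q inv] inner2_Leibniz[OF p q p inv]
        inner2_Leibniz[OF p q q inv])
  moreover note inner2_alpha[OF p q inv]
  \<comment> \<open>Every other axiom is now available, so the bialgebra property is equivalent to
    Hom-coassociativity, which \<open>coassoc_iff\<close> translates for each \<open>a\<close>
    separately.\<close>
  ultimately have "covariant_hom_bialgebra sc \<alpha> \<mu> (\<lambda>c. cls sc (inner2 p q c))
      (\<lambda>c. cls sc (inner2 p p c)) (\<lambda>c. cls sc (inner2 q q c)) \<longleftrightarrow>
      (\<forall>a. map_Da sc \<alpha> (\<lambda>c. cls sc (inner2 p q c)) (cls sc (inner2 p q a))
         = map_aD sc \<alpha> (\<lambda>c. cls sc (inner2 p q c)) (cls sc (inner2 p q a)))"
    by (auto simp: covariant_hom_bialgebra_def covariant_hom_bialgebra_axioms_def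
        hom_coassociative_coalgebra_def hom_coassociative_coalgebra_axioms_def
        linear_alpha hom_associative_algebra_axioms vector_space_axioms)
  then show ?thesis
    unfolding rs inner2_cls by (simp only: coassoc_iff[OF p q inv])
qed

end
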